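(* Let $(A,\rhd,\lhd)$ be a dialgebra and $r\in A\otimes A$ be such that the skew-symmetric part of $r$ is invariant. Then $r$ is a solution of the diassociative Yang-Baxter equation (DAYBE) in $(A,\rhd,\lhd)$ if and only if for all $a^*,b^*\in A^*$ the following equations hold: $$\widetilde{r}(a^* )\rhd\widetilde{r}(b^* )=\widetilde{r}\big(-R_{\lhd}^*(\widetilde{r}(a^* ))b^*-L_{\star}^*(\widetilde{r}^t(b^* ))a^*\big),$$ $$\widetilde{r}(a^* )\lhd\widetilde{r}(b^* )=\widetilde{r}\big(R_{\star}^*(\widetilde{r}(a^* ))b^*-L_{\rhd}^*(\widetilde{r}^t(b^* ))a^*\big).$$
   Context: All vector spaces and algebras are finite-dimensional over a field $\mathbb F$ of characteristic $0$; algebras are not assumed unital. A dialgebra is $(A,\rhd,\lhd)$ where $\rhd,\lhd$ are associative bilinear products with $(x\lhd y)\lhd z=x\lhd(y\rhd z)$, $(x\rhd y)\lhd z=x\rhd(y\lhd z)$, $(x\lhd y)\rhd z=x\rhd(y\rhd z)$. Notation: $x\star y=x\rhd y-x\lhd y$; $L_\diamond(x)y=x\diamond y=R_\diamond(y)x$; $\tau(x\otimes y)=y\otimes x$. For linear $\varphi:A\to\mathrm{End}(V)$, $\varphi^*:A\to\mathrm{End}(V^* )$ is given by $\langle\varphi^*(x)v^*,u\rangle=-\langle v^*,\varphi(x)u\rangle$ (note the sign). For $r\in A\otimes A$, the maps $\widetilde{r},\widetilde{r}^t:A^*\to A$ are defined by $\langle\widetilde{r}(u^* ),v^*\rangle=\langle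 r,u^*\otimes v^*\rangle=\langle\widetilde{r}^t(v^* ),u^*\rangle$. $r=\sum_i a_i\otimes b_i\in A\otimes A$ is a solution of the DAYBE if $r_{13}\rhd r_{23}-r_{23}\lhd r_{12}-r_{12}\star r_{13}=0$, i.e. $\sum_{i,j}\big(a_i\otimes a_j\otimes b_i\rhd b_j-a_j\otimes a_i\lhd b_j\otimes b_i-a_i\star a_j\otimes b_i\otimes b_j\big)=0$ in $A\otimes A\otimes A$. The skew-symmetric part of $r$ is $\alpha=r-\tau(r)$. An element $s\in A\otimes A$ is invariant if $(R_{\star}(x)\otimes\mathrm{id}+\mathrm{id}\otimes L_{\lhd}(x))s=0$ and $(R_{\rhd}(x)\otimes\mathrm{id}-\mathrm{id}\otimes L_{\star}(x))s=0$ for all $x\in A$. *)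

theory Defs
  imports Complex_Main "HOL-Library.Function_Algebras"
begin

section \<open>Tensor powers of a vector space\<close>

text \<open>
  The library has no tensor product of vector spaces. For \<open>A\<close> a vector space over \<open>F\<close>, we realise
  \<open>A \<otimes> A\<close> in the usual way inside the dual of the space of bilinear forms on \<open>A\<close>: the simple tensor
  \<open>a \<otimes> b\<close> is the evaluation \<open>\<beta> \<mapsto> \<beta>(a, b)\<close>, and \<open>A \<otimes> A\<close> consists of the finite sums of simple
  tensors. Since HOL functions are total, \<open>a \<otimes> b\<close> is set to 0 on arguments that are not bilinear.
  Addition of tensors is the pointwise one of \<open>HOL-Library.Function_Algebras\<close>.
  The universal property is \<open>tensor_lift_sum\<close> below; \<open>A \<otimes> A \<otimes> A\<close> is treated in the same way
  with trilinear forms.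
\<close>

definition bilinear_map ::
  "('f::field \<Rightarrow> 'a::ab_group_add \<Rightarrow> 'a) \<Rightarrow> ('f \<Rightarrow> 'b::ab_group_add \<Rightarrow> 'b) \<Rightarrow> ('a \<Rightarrow> 'a \<Rightarrow> 'b) \<Rightarrow> bool"
  where "bilinear_map s t h \<longleftrightarrow>
    (\<forall>x. Vector_Spaces.linear s t (\<lambda>y. h x y)) \<and> (\<forall>y. Vector_Spaces.linear s t (\<lambda>x. h x y))"

definition trilinear_map ::
  "('f::field \<Rightarrow> 'a::ab_group_add \<Rightarrow> 'a) \<Rightarrow> ('f \<Rightarrow> 'b::ab_group_add \<Rightarrow> 'b) \<Rightarrow> ('a \<Rightarrow> 'a \<Rightarrow> 'a \<Rightarrow> 'b) \<Rightarrow> bool"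
  where "trilinear_map s t h \<longleftrightarrow>
    (\<forall>x y. Vector_Spaces.linear s t (\<lambda>z. h x y z)) \<and>
    (\<forall>x z. Vector_Spaces.linear s t (\<lambda>y. h x y z)) \<and>
    (\<forall>y z. Vector_Spaces.linear s t (\<lambda>x. h x y z))"

type_synonym ('a, 'f) tensor2 = "('a \<Rightarrow> 'a \<Rightarrow> 'f) \<Rightarrow> 'f"
type_synonym ('a, 'f) tensor3 = "('a \<Rightarrow> 'a \<Rightarrow> 'a \<Rightarrow> 'f) \<Rightarrow> 'f"

definition fun_scale :: "'f::field \<Rightarrow> ('b \<Rightarrow> 'f) \<Rightarrow> 'b \<Rightarrow> 'f"
  where "fun_scale c t = (\<lambda>\<beta>. c * t \<beta>)"

definition tens2 ::
  "('f::field \<Rightarrow> 'a::ab_group_add \<Rightarrow> 'a) \<Rightarrow> 'a \<Rightarrow> 'a \<Rightarrow> ('a, 'f) tensor2"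
  where "tens2 s a b = (\<lambda>\<beta>. if bilinear_map s (*) \<beta> then \<beta> a b else 0)"

definition tens3 ::
  "('f::field \<Rightarrow> 'a::ab_group_add \<Rightarrow> 'a) \<Rightarrow> 'a \<Rightarrow> 'a \<Rightarrow> 'a \<Rightarrow> ('a, 'f) tensor3"
  where "tens3 s a b c = (\<lambda>\<gamma>. if trilinear_map s (*) \<gamma> then \<gamma> a b c else 0)"

definition tensor_square ::
  "('f::field \<Rightarrow> 'a::ab_group_add \<Rightarrow> 'a) \<Rightarrow> ('a, 'f) tensor2 set"
  where "tensor_square s = {t. \<exists>(n::nat) a b. t = (\<Sum>i<n. tens2 s (a i) (b i))}"

text \<open>
  \<open>tensor_lift s h\<close> is the linear map on \<open>A \<otimes> A\<close> induced by a bilinear map \<open>h\<close>, that is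
  \<open>\<Sum>\<^sub>i a\<^sub>i \<otimes> b\<^sub>i \<mapsto> \<Sum>\<^sub>i h(a\<^sub>i, b\<^sub>i)\<close>; see \<open>tensor_lift_sum\<close> for the independence
  of the decomposition.
\<close>
definition tensor_lift ::
  "('f::field \<Rightarrow> 'a::ab_group_add \<Rightarrow> 'a) \<Rightarrow> ('a \<Rightarrow> 'a \<Rightarrow> 'b::comm_monoid_add) \<Rightarrow> ('a, 'f) tensor2 \<Rightarrow> 'b"
  where "tensor_lift s h t =
    (THE w. \<exists>(n::nat) a b. t = (\<Sum>i<n. tens2 s (a i) (b i)) \<and> w = (\<Sum>i<n. h (a i) (b i)))"

definition tensor_map ::
  "('f::field \<Rightarrow> 'a::ab_group_add \<Rightarrow> 'a) \<Rightarrow> ('a \<Rightarrow> 'a) \<Rightarrow> ('a \<Rightarrow> 'a) \<Rightarrow> ('a, 'f) tensor2 \<Rightarrow> ('a, 'f) tensor2"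
  where "tensor_map s f g = tensor_lift s (\<lambda>a b. tens2 s (f a) (g b))"

definition tensor_flip ::
  "('f::field \<Rightarrow> 'a::ab_group_add \<Rightarrow> 'a) \<Rightarrow> ('a, 'f) tensor2 \<Rightarrow> ('a, 'f) tensor2"
  where "tensor_flip s = tensor_lift s (\<lambda>a b. tens2 s b a)"

definition skew_part ::
  "('f::field \<Rightarrow> 'a::ab_group_add \<Rightarrow> 'a) \<Rightarrow> ('a, 'f) tensor2 \<Rightarrow> ('a, 'f) tensor2"
  where "skew_part s r = r - tensor_flip s r"


section \<open>Duality\<close>

definition dual_space :: "('f::field \<Rightarrow> 'a::ab_group_add \<Rightarrow> 'a) \<Rightarrow> ('a \<Rightarrow> 'f) set"
  where "dual_space s = {u. Vector_Spaces.linear s (*) u}"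

definition tensor_pairing ::
  "('f::field \<Rightarrow> 'a::ab_group_add \<Rightarrow> 'a) \<Rightarrow> ('a, 'f) tensor2 \<Rightarrow> ('a \<Rightarrow> 'f) \<Rightarrow> ('a \<Rightarrow> 'f) \<Rightarrow> 'f"
  where "tensor_pairing s r u v = tensor_lift s (\<lambda>a b. u a * v b) r"

definition tilde ::
  "('f::field \<Rightarrow> 'a::ab_group_add \<Rightarrow> 'a) \<Rightarrow> ('a, 'f) tensor2 \<Rightarrow> ('a \<Rightarrow> 'f) \<Rightarrow> 'a"
  where "tilde s r u = (THE x. \<forall>v\<in>dual_space s. v x = tensor_pairing s r u v)"

definition tilde_t ::
  "('f::field \<Rightarrow> 'a::ab_group_add \<Rightarrow> 'a) \<Rightarrow> ('a, 'f) tensor2 \<Rightarrow> ('a \<Rightarrow> 'f) \<Rightarrow> 'a"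
  where "tilde_t s r v = (THE x. \<forall>u\<in>dual_space s. u x = tensor_pairing s r u v)"

text \<open>The dual \<open>\<phi>\<^sup>*\<close> of a map \<open>\<phi>\<close> from \<open>A\<close> to the endomorphisms of \<open>V\<close>, with the minus sign.\<close>
definition dual_action :: "('a \<Rightarrow> 'v \<Rightarrow> 'v) \<Rightarrow> 'a \<Rightarrow> ('v \<Rightarrow> 'f::field) \<Rightarrow> 'v \<Rightarrow> 'f"
  where "dual_action \<phi> x v = (\<lambda>u. - v (\<phi> x u))"


section \<open>Dialgebras and the diassociative Yang-Baxter equation\<close>

locale dialgebra = finite_dimensional_vector_space scale Basis
  for scale :: "'f::field_char_0 \<Rightarrow> 'a::ab_group_add \<Rightarrow> 'a" and Basis :: "'a set" +
  fixes rprod :: "'a \<Rightarrow> 'a \<Rightarrow> 'a" (infixl "\<rhd>" 70)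
    and lprod :: "'a \<Rightarrow> 'a \<Rightarrow> 'a" (infixl "\<lhd>" 70)
  assumes bilinear_rprod: "bilinear_map scale scale (\<rhd>)"
    and bilinear_lprod: "bilinear_map scale scale (\<lhd>)"
    and assoc_rprod: "(x \<rhd> y) \<rhd> z = x \<rhd> (y \<rhd> z)"
    and assoc_lprod: "(x \<lhd> y) \<lhd> z = x \<lhd> (y \<lhd> z)"
    and lprod_lprod: "(x \<lhd> y) \<lhd> z = x \<lhd> (y \<rhd> z)"
    and rprod_lprod: "(x \<rhd> y) \<lhd> z = x \<rhd> (y \<lhd> z)"
    and lprod_rprod: "(x \<lhd> y) \<rhd> z = x \<rhd> (y \<rhd> z)"

definition star_prod :: "('a \<Rightarrow> 'a \<Rightarrow> 'a::ab_group_add) \<Rightarrow> ('a \<Rightarrow> 'a \<Rightarrow> 'a) \<Rightarrow> 'a \<Rightarrow> 'a \<Rightarrow> 'a"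
  where "star_prod rp lp x y = rp x y - lp x y"

definition Lmult :: "('a \<Rightarrow> 'a \<Rightarrow> 'a) \<Rightarrow> 'a \<Rightarrow> 'a \<Rightarrow> 'a"
  where "Lmult m x = (\<lambda>y. m x y)"

definition Rmult :: "('a \<Rightarrow> 'a \<Rightarrow> 'a) \<Rightarrow> 'a \<Rightarrow> 'a \<Rightarrow> 'a"
  where "Rmult m y = (\<lambda>x. m x y)"

definition invariant_tensor ::
  "('f::field \<Rightarrow> 'a::ab_group_add \<Rightarrow> 'a) \<Rightarrow> ('a \<Rightarrow> 'a \<Rightarrow> 'a) \<Rightarrow> ('a \<Rightarrow> 'a \<Rightarrow> 'a) \<Rightarrow> ('a, 'f) tensor2 \<Rightarrow> bool"
  where "invariant_tensor s rp lp t \<longleftrightarrow>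
    (\<forall>x. tensor_map s (Rmult (star_prod rp lp) x) id t + tensor_map s id (Lmult lp x) t = 0 \<and>
         tensor_map s (Rmult rp x) id t - tensor_map s id (Lmult (star_prod rp lp) x) t = 0)"

text \<open>
  With \<open>r = \<Sum>\<^sub>i a\<^sub>i \<otimes> b\<^sub>i\<close>, the outer lift is the sum over \<open>i\<close> (with \<open>a, b\<close> for \<open>a\<^sub>i, b\<^sub>i\<close>) and the
  inner one the sum over \<open>j\<close> (with \<open>a', b'\<close> for \<open>a\<^sub>j, b\<^sub>j\<close>); see \<open>daybe_sum_iff\<close> below.
\<close>
definition daybe ::
  "('f::field \<Rightarrow> 'a::ab_group_add \<Rightarrow> 'a) \<Rightarrow> ('a \<Rightarrow> 'a \<Rightarrow> 'a) \<Rightarrow> ('a \<Rightarrow> 'a \<Rightarrow> 'a) \<Rightarrow> ('a, 'f) tensor2 \<Rightarrow> bool"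
  where "daybe s rp lp r \<longleftrightarrow>
    tensor_lift s (\<lambda>a b. tensor_lift s (\<lambda>a' b'.
        tens3 s a a' (rp b b') - tens3 s a' (lp a b') b - tens3 s (star_prod rp lp a a') b b') r) r
    = (0 :: ('a, 'f) tensor3)"


section \<open>Well-definedness\<close>

lemma fun_scale_vector_space: "vector_space (fun_scale :: 'f::field \<Rightarrow> ('b \<Rightarrow> 'f) \<Rightarrow> 'b \<Rightarrow> 'f)"
  by unfold_locales (auto simp: fun_scale_def fun_eq_iff algebra_simps)

lemma field_vector_space: "vector_space ((*) :: 'f::field \<Rightarrow> 'f \<Rightarrow> 'f)"
  by unfold_locales (auto simp: algebra_simps)

lemma bilinear_map_iff:
  assumes "vector_space s" "vector_space t"
  shows "bilinear_map s t h \<longleftrightarrow>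
    (\<forall>x y z. h x (y + z) = h x y + h x z) \<and> (\<forall>x y z. h (x + y) z = h x z + h y z) \<and>
    (\<forall>c x y. h x (s c y) = t c (h x y)) \<and> (\<forall>c x y. h (s c x) y = t c (h x y))"
  using assms unfolding bilinear_map_def Vector_Spaces.linear_iff by blast

lemma trilinear_map_iff:
  assumes "vector_space s" "vector_space t"
  shows "trilinear_map s t h \<longleftrightarrow>
    (\<forall>x y z w. h x y (z + w) = h x y z + h x y w) \<and>
    (\<forall>x y z w. h x (y + w) z = h x y z + h x w z) \<and>
    (\<forall>x y z w. h (x + w) y z = h x y z + h w y z) \<and>
    (\<forall>c x y z. h x y (s c z) = t c (h x y z)) \<and>
    (\<forall>c x y z. h x (s c y) z = t c (h x y z)) \<and>
    (\<forall>c x y z. h (s c x) y z = t c (h x y z))"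
  using assms unfolding trilinear_map_def Vector_Spaces.linear_iff by (intro iffI) auto

lemma bilinear_tens2:
  assumes "vector_space s" shows "bilinear_map s fun_scale (tens2 s)"
  unfolding bilinear_map_iff[OF assms fun_scale_vector_space]
  by (auto simp: tens2_def fun_scale_def fun_eq_iff
      bilinear_map_iff[OF assms field_vector_space])

lemma trilinear_tens3:
  assumes "vector_space s" shows "trilinear_map s fun_scale (tens3 s)"
  unfolding trilinear_map_iff[OF assms fun_scale_vector_space]
  by (auto simp: tens3_def fun_scale_def fun_eq_iff
      trilinear_map_iff[OF assms field_vector_space])

lemma functionals_separate:
  fixes s :: "'f::field \<Rightarrow> 'a::ab_group_add \<Rightarrow> 'a"
  assumes vs: "vector_space s" and "\<And>u. u \<in> dual_space s \<Longrightarrow> u x = u y"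
  shows "x = y"
proof (rule ccontr)
  assume "x \<noteq> y"
  interpret V: vector_space_pair s "(*) :: 'f \<Rightarrow> 'f \<Rightarrow> 'f"
    using vs field_vector_space by (rule vector_space_pair.intro)
  have "V.vs1.independent {x - y}" using \<open>x \<noteq> y\<close> by simp
  from V.linear_independent_extend[OF this, of "\<lambda>_. 1"]
  obtain u where u: "Vector_Spaces.linear s (*) u" "u (x - y) = 1" by auto
  then have "u x - u y = 1" by (metis V.linear_diff)
  moreover have "u x = u y" using assms(2) u(1) by (simp add: dual_space_def)
  ultimately show False by simp
qed

lemma sum_fun_apply: "(\<Sum>i\<in>I. f i) x = (\<Sum>i\<in>I. f i x)"
  by (induction I rule: infinite_finite_induct) auto

lemma tensor_lift_sum:
  fixes t :: "'f::field \<Rightarrow> 'b::ab_group_add \<Rightarrow> 'b"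
  assumes s: "vector_space s" and t: "vector_space t" and h: "bilinear_map s t h"
  shows "tensor_lift s h (\<Sum>i<(n::nat). tens2 s (a i) (b i)) = (\<Sum>i<n. h (a i) (b i))"
  unfolding tensor_lift_def
proof (rule the_equality)
  show "\<exists>m a' b'. (\<Sum>i<n. tens2 s (a i) (b i)) = (\<Sum>i<(m::nat). tens2 s (a' i) (b' i)) \<and>
      (\<Sum>i<n. h (a i) (b i)) = (\<Sum>i<m. h (a' i) (b' i))" by blast
next
  fix w
  assume "\<exists>m a' b'. (\<Sum>i<n. tens2 s (a i) (b i)) = (\<Sum>i<(m::nat). tens2 s (a' i) (b' i)) \<and>
      w = (\<Sum>i<m. h (a' i) (b' i))"
  then obtain m :: nat and a' b' where
    eq: "(\<Sum>i<n. tens2 s (a i) (b i)) = (\<Sum>i<m. tens2 s (a' i) (b' i))"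
    and w: "w = (\<Sum>i<m. h (a' i) (b' i))" by blast
  show "w = (\<Sum>i<n. h (a i) (b i))"
  proof (rule functionals_separate[OF t])
    fix u assume "u \<in> dual_space t"
    then have u: "Vector_Spaces.linear t (*) u" by (simp add: dual_space_def)
    interpret u: Vector_Spaces.linear t "(*)" u by (rule u)
    let ?\<beta> = "\<lambda>x y. u (h x y)"
    have "bilinear_map s (*) ?\<beta>"
      using h unfolding bilinear_map_iff[OF s t]
        bilinear_map_iff[OF s field_vector_space]
      by (simp add: u.add u.scale)
    then have "(\<Sum>i<n. tens2 s (a i) (b i)) ?\<beta> = u (\<Sum>i<n. h (a i) (b i))"
      and "(\<Sum>i<m. tens2 s (a' i) (b' i)) ?\<beta> = u (\<Sum>i<m. h (a' i) (b' i))"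
      by (simp_all add: sum_fun_apply tens2_def u.sum)
    with eq w show "u w = u (\<Sum>i<n. h (a i) (b i))" by simp
  qed
qed

lemma tensor_pairing_sum:
  assumes s: "vector_space s" and u: "u \<in> dual_space s" and v: "v \<in> dual_space s"
  shows "tensor_pairing s (\<Sum>i<(n::nat). tens2 s (a i) (b i)) u v = (\<Sum>i<n. u (a i) * v (b i))"
  unfolding tensor_pairing_def
proof (rule tensor_lift_sum[OF s field_vector_space])
  show "bilinear_map s (*) (\<lambda>a b. u a * v b)"
    using u v unfolding bilinear_map_iff[OF s field_vector_space]
      dual_space_def Vector_Spaces.linear_iff by (auto simp: algebra_simps)
qed

lemma tilde_sum:
  assumes s: "vector_space s" and u: "u \<in> dual_space s"
  shows "tilde s (\<Sum>i<(n::nat). tens2 s (a i) (b i)) u = (\<Sum>i<n. s (u (a i)) (b i))"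
  unfolding tilde_def
proof (rule the_equality)
  have *: "v (\<Sum>i<n. s (u (a i)) (b i)) = (\<Sum>i<n. u (a i) * v (b i))" if "v \<in> dual_space s" for v
  proof -
    interpret v: Vector_Spaces.linear s "(*)" v using that by (simp add: dual_space_def)
    show ?thesis by (simp add: v.sum v.scale)
  qed
  then show "\<forall>v\<in>dual_space s. v (\<Sum>i<n. s (u (a i)) (b i)) =
      tensor_pairing s (\<Sum>i<n. tens2 s (a i) (b i)) u v"
    using tensor_pairing_sum[OF s u] by simp
  show "x = (\<Sum>i<n. s (u (a i)) (b i))"
    if "\<forall>v\<in>dual_space s. v x = tensor_pairing s (\<Sum>i<n. tens2 s (a i) (b i)) u v" for x
    using that * tensor_pairing_sum[OF s u] by (intro functionals_separate[OF s]) simp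
qed

lemma tilde_t_sum:
  assumes s: "vector_space s" and v: "v \<in> dual_space s"
  shows "tilde_t s (\<Sum>i<(n::nat). tens2 s (a i) (b i)) v = (\<Sum>i<n. s (v (b i)) (a i))"
  unfolding tilde_t_def
proof (rule the_equality)
  have *: "u (\<Sum>i<n. s (v (b i)) (a i)) = (\<Sum>i<n. u (a i) * v (b i))" if "u \<in> dual_space s" for u
  proof -
    interpret u: Vector_Spaces.linear s "(*)" u using that by (simp add: dual_space_def)
    show ?thesis by (simp add: u.sum u.scale mult.commute)
  qed
  then show "\<forall>u\<in>dual_space s. u (\<Sum>i<n. s (v (b i)) (a i)) =
      tensor_pairing s (\<Sum>i<n. tens2 s (a i) (b i)) u v"
    using tensor_pairing_sum[OF s _ v] by simp
  show "x = (\<Sum>i<n. s (v (b i)) (a i))"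
    if "\<forall>u\<in>dual_space s. u x = tensor_pairing s (\<Sum>i<n. tens2 s (a i) (b i)) u v" for x
    using that * tensor_pairing_sum[OF s _ v] by (intro functionals_separate[OF s]) simp
qed

lemma tensor_flip_sum:
  assumes s: "vector_space s"
  shows "tensor_flip s (\<Sum>i<(n::nat). tens2 s (a i) (b i)) = (\<Sum>i<n. tens2 s (b i) (a i))"
  unfolding tensor_flip_def
  by (rule tensor_lift_sum[OF s fun_scale_vector_space])
     (use bilinear_tens2[OF s] in \<open>simp add: bilinear_map_def\<close>)

lemma tensor_map_sum:
  assumes s: "vector_space s" and f: "Vector_Spaces.linear s s f" and g: "Vector_Spaces.linear s s g"
  shows "tensor_map s f g (\<Sum>i<(n::nat). tens2 s (a i) (b i)) = (\<Sum>i<n. tens2 s (f (a i)) (g (b i)))"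
  unfolding tensor_map_def
proof (rule tensor_lift_sum[OF s fun_scale_vector_space])
  show "bilinear_map s fun_scale (\<lambda>a b. tens2 s (f a) (g b))"
    using bilinear_tens2[OF s] f g
    unfolding bilinear_map_iff[OF s fun_scale_vector_space] Vector_Spaces.linear_iff by simp
qed

lemma daybe_sum_iff:
  fixes s :: "'f::field \<Rightarrow> 'a::ab_group_add \<Rightarrow> 'a"
  assumes s: "vector_space s" and rp: "bilinear_map s s rp" and lp: "bilinear_map s s lp"
  shows "daybe s rp lp (\<Sum>i<(n::nat). tens2 s (a i) (b i)) \<longleftrightarrow>
    (\<Sum>i<n. \<Sum>j<n. tens3 s (a i) (a j) (rp (b i) (b j)) - tens3 s (a j) (lp (a i) (b j)) (b i)
      - tens3 s (star_prod rp lp (a i) (a j)) (b i) (b j)) = 0"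
proof -
  interpret F: vector_space "fun_scale :: 'f \<Rightarrow> ('a, 'f) tensor3 \<Rightarrow> ('a, 'f) tensor3"
    by (rule fun_scale_vector_space)
  interpret s: vector_space s by (rule s)
  let ?F = "\<lambda>x y x' y'. tens3 s x x' (rp y y') - tens3 s x' (lp x y') y - tens3 s (star_prod rp lp x x') y y'"
  note lin = trilinear_tens3[OF s, unfolded trilinear_map_iff[OF s fun_scale_vector_space]]
    rp[unfolded bilinear_map_iff[OF s s]] lp[unfolded bilinear_map_iff[OF s s]]
  have star: "star_prod rp lp x (y + z) = star_prod rp lp x y + star_prod rp lp x z"
     "star_prod rp lp (x + y) z = star_prod rp lp x z + star_prod rp lp y z"
     "star_prod rp lp x (s c y) = s c (star_prod rp lp x y)"
     "star_prod rp lp (s c x) y = s c (star_prod rp lp x y)" for x y z c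
    using lin(2,3) by (simp_all add: star_prod_def s.scale_right_diff_distrib)
  have inner: "bilinear_map s fun_scale (?F x y)" for x y
    unfolding bilinear_map_iff[OF s fun_scale_vector_space]
    using lin by (simp add: star F.scale_right_diff_distrib)
  have eq: "tensor_lift s (?F x y) (\<Sum>i<n. tens2 s (a i) (b i)) = (\<Sum>j<n. ?F x y (a j) (b j))" for x y
    by (rule tensor_lift_sum[OF s fun_scale_vector_space inner])
  have "bilinear_map s fun_scale (\<lambda>x y. \<Sum>j<n. ?F x y (a j) (b j))"
    unfolding bilinear_map_iff[OF s fun_scale_vector_space]
    using lin
    by (simp add: star F.scale_right_diff_distrib F.scale_sum_right
        sum.distrib[symmetric] sum_subtractf[symmetric] algebra_simps del: sum_subtractf)
  from tensor_lift_sum[OF s fun_scale_vector_space this, where n = n and a = a and b = b]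
  show ?thesis unfolding daybe_def eq by simp
qed

end

theory Submission
  imports Defs
begin

text \<open>
  Write \<open>R\<close> and \<open>T\<close> for the two maps induced by \<open>r\<close>, and
  \<open>D(u, v, w) = w(Ru \<rhd> Rv) - v(Tw \<lhd> Ru) - u(Tv \<star> Tw)\<close>. Evaluating the DAYBE on
  \<open>u \<otimes> v \<otimes> w\<close> gives \<open>D(u, v, w)\<close>, so the DAYBE says that \<open>D\<close> vanishes identically. As
  \<open>w(R f) = f(T w)\<close>, this is literally the first equation. Testing the second one against
  \<open>w\<close> gives the expression \<open>E(u, v, w) = w(Ru \<lhd> Rv) + v(Tw \<star> Ru) - u(Tv \<rhd> Tw)\<close>. With
  \<open>\<delta> = R - T\<close>, invariance of the skew-symmetric part says
  \<open>q(x \<lhd> \<delta>p) = p(\<delta>q \<star> x)\<close> and \<open>q(x \<star> \<delta>p) = - p(\<delta>q \<rhd> x)\<close>, whose sum is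
  \<open>q(x \<rhd> \<delta>p) = - p(\<delta>q \<lhd> x)\<close>. Together these give \<open>E(u, v, w) = - D(v, w, u)\<close>, so that the second
  equation follows from the first.
\<close>

section \<open>Bilinear products and linear functionals\<close>

lemma bilinear_star_prod:
  assumes s: "vector_space s" and rp: "bilinear_map s s rp" and lp: "bilinear_map s s lp"
  shows "bilinear_map s s (star_prod rp lp)"
proof -
  interpret vector_space s by (rule s)
  show ?thesis
    using rp lp unfolding bilinear_map_iff[OF s s]
    by (simp add: star_prod_def scale_right_diff_distrib)
qed

lemma linear_Lmult: "bilinear_map s s h \<Longrightarrow> Vector_Spaces.linear s s (Lmult h x)"
  by (simp add: bilinear_map_def Lmult_def)

lemma linear_Rmult: "bilinear_map s s h \<Longrightarrow> Vector_Spaces.linear s s (Rmult h x)"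
  by (simp add: bilinear_map_def Rmult_def)

lemma dual_space_compose:
  assumes "Vector_Spaces.linear s s f" "u \<in> dual_space s"
  shows "(\<lambda>x. u (f x)) \<in> dual_space s"
  using assms by (simp add: dual_space_def Vector_Spaces.linear_iff)

lemma dual_space_add:
  "u \<in> dual_space s \<Longrightarrow> v \<in> dual_space s \<Longrightarrow> (\<lambda>x. u x + v x) \<in> dual_space s"
  by (simp add: dual_space_def Vector_Spaces.linear_iff algebra_simps)

lemma dual_space_diff:
  "u \<in> dual_space s \<Longrightarrow> v \<in> dual_space s \<Longrightarrow> (\<lambda>x. u x - v x) \<in> dual_space s"
  by (simp add: dual_space_def Vector_Spaces.linear_iff algebra_simps)

lemma dual_space_apply_add: "u \<in> dual_space s \<Longrightarrow> u (x + y) = u x + u y"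
  by (simp add: dual_space_def Vector_Spaces.linear_iff)

lemma dual_space_apply_diff: "u \<in> dual_space s \<Longrightarrow> u (x - y) = u x - u y"
  by (metis add_diff_cancel diff_add_cancel dual_space_apply_add)

lemma bilinear_map_diff:
  assumes "vector_space s" "vector_space t" "bilinear_map s t h"
  shows "h x (y - z) = h x y - h x z" "h (x - y) z = h x z - h y z"
  using assms(3) unfolding bilinear_map_iff[OF assms(1,2)]
  by (metis add_diff_cancel diff_add_cancel)+

lemma bilinear_map_product:
  assumes s: "vector_space s" and "u \<in> dual_space s" "v \<in> dual_space s"
  shows "bilinear_map s (*) (\<lambda>x y. u x * v y)"
  using assms(2,3) unfolding bilinear_map_iff[OF s field_vector_space] dual_space_def
    Vector_Spaces.linear_iff by (auto simp: algebra_simps)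

lemma trilinear_map_product:
  assumes s: "vector_space s" and "u \<in> dual_space s" "v \<in> dual_space s" "w \<in> dual_space s"
  shows "trilinear_map s (*) (\<lambda>x y z. u x * v y * w z)"
  using assms(2-) unfolding trilinear_map_iff[OF s field_vector_space] dual_space_def
    Vector_Spaces.linear_iff by (auto simp: algebra_simps)

lemma tens2_apply: "bilinear_map s (*) \<beta> \<Longrightarrow> tens2 s x y \<beta> = \<beta> x y"
  by (simp add: tens2_def)

lemma tens3_apply: "trilinear_map s (*) \<gamma> \<Longrightarrow> tens3 s x y z \<gamma> = \<gamma> x y z"
  by (simp add: tens3_def)

text \<open>By \<open>tilde_sum\<close> and \<open>tilde_t_sum\<close>, the values of both induced
  maps are linear combinations of the components of \<open>r\<close>. Products of such values thus
  become double sums over its terms.\<close>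

lemma dual_apply_bilinear_sum:
  assumes s: "vector_space s" and h: "bilinear_map s s h" and w: "w \<in> dual_space s"
  shows "w (h (\<Sum>i\<in>I. s (c i) (x i)) (\<Sum>j\<in>J. s (d j) (y j)))
    = (\<Sum>i\<in>I. \<Sum>j\<in>J. c i * d j * w (h (x i) (y j)))"
proof -
  interpret w: Vector_Spaces.linear s "(*)" w using w by (simp add: dual_space_def)
  interpret l: Vector_Spaces.linear s s "\<lambda>p. h p q" for q
    using h by (simp add: bilinear_map_def)
  interpret r: Vector_Spaces.linear s s "\<lambda>q. h p q" for p
    using h by (simp add: bilinear_map_def)
  show ?thesis
    by (simp only: l.sum l.scale r.sum r.scale w.sum w.scale sum_distrib_left mult.assoc)
      (subst sum.swap, simp only: mult.left_commute)
qed

section \<open>The tensor square and its pairing with functionals\<close>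

lemma tensor_square_add_tens2:
  assumes "t \<in> tensor_square s" shows "t + tens2 s x y \<in> tensor_square s"
proof -
  from assms obtain n :: nat and a b where t: "t = (\<Sum>i<n. tens2 s (a i) (b i))"
    by (auto simp: tensor_square_def)
  \<comment> \<open>Index \<open>n\<close> is the first one outside the sum for \<open>t\<close>, so
    overwriting the families there appends the new term.\<close>
  have "t + tens2 s x y = (\<Sum>i<Suc n. tens2 s ((a(n := x)) i) ((b(n := y)) i))"
    by (simp add: t)
  then show ?thesis unfolding tensor_square_def by blast
qed

text \<open>Elements of \<open>tensor_square\<close> are sums without coefficients, so each
  subtracted term is appended as a simple tensor with the sign absorbed into its first
  factor.\<close>

lemma tensor_square_diff_sum:
  fixes m :: nat
  assumes s: "vector_space s" and "t \<in> tensor_square s"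
  shows "t - (\<Sum>i<m. tens2 s (a i) (b i)) \<in> tensor_square s"
proof (induction m)
  case 0
  then show ?case using assms by simp
next
  case (Suc m)
  have "tens2 s (- x) y = - tens2 s x y" for x y
    using bilinear_map_diff(2)[OF s fun_scale_vector_space bilinear_tens2[OF s], of 0 x y]
      bilinear_map_diff(2)[OF s fun_scale_vector_space bilinear_tens2[OF s], of 0 0 y]
    by simp
  then have "t - (\<Sum>i<Suc m. tens2 s (a i) (b i))
      = t - (\<Sum>i<m. tens2 s (a i) (b i)) + tens2 s (- a m) (b m)"
    by (simp only: sum.lessThan_Suc diff_diff_eq add_uminus_conv_diff)
  with tensor_square_add_tens2[OF Suc.IH] show ?case by (simp only:)
qed

text \<open>The lifts behind \<open>tensor_map\<close> and \<open>tensor_pairing\<close> are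
  computed on finite sums of simple tensors, so the skew-symmetric part must first be exhibited as
  one.\<close>

lemma skew_part_in_tensor_square:
  assumes s: "vector_space s" and "r \<in> tensor_square s"
  shows "skew_part s r \<in> tensor_square s"
proof -
  from assms(2) obtain n :: nat and a b where "r = (\<Sum>i<n. tens2 s (a i) (b i))"
    by (auto simp: tensor_square_def)
  then show ?thesis
    using tensor_square_diff_sum[OF s assms(2)] by (simp add: skew_part_def tensor_flip_sum[OF s])
qed

text \<open>A tensor is itself a functional on bilinear forms, so sums and differences of tensors
  can be paired pointwise.\<close>

lemma tensor_pairing_eq_apply:
  assumes s: "vector_space s" and t: "t \<in> tensor_square s"
    and "u \<in> dual_space s" "v \<in> dual_space s"
  shows "tensor_pairing s t u v = t (\<lambda>x y. u x * v y)"
proof -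
  from t obtain n :: nat and a b where t: "t = (\<Sum>i<n. tens2 s (a i) (b i))"
    by (auto simp: tensor_square_def)
  show ?thesis
    using bilinear_map_product[OF s assms(3,4)]
    by (simp add: t tensor_pairing_sum[OF s assms(3,4)] sum_fun_apply tens2_apply)
qed

text \<open>Transposing \<open>f\<close> and \<open>g\<close> onto the functionals is what later
  turns the invariance conditions into scalar identities.\<close>

lemma tensor_map_apply_product:
  assumes s: "vector_space s" and t: "t \<in> tensor_square s"
    and f: "Vector_Spaces.linear s s f" and g: "Vector_Spaces.linear s s g"
    and u: "u \<in> dual_space s" and v: "v \<in> dual_space s"
  shows "tensor_map s f g t (\<lambda>x y. u x * v y) = tensor_pairing s t (\<lambda>x. u (f x)) (\<lambda>x. v (g x))"
proof -
  from t obtain n :: nat and a b where t: "t = (\<Sum>i<n. tens2 s (a i) (b i))"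
    by (auto simp: tensor_square_def)
  show ?thesis
    using bilinear_map_product[OF s u v]
    by (simp add: t tensor_map_sum[OF s f g] sum_fun_apply tens2_apply
        tensor_pairing_sum[OF s dual_space_compose[OF f u] dual_space_compose[OF g v]])
qed

lemma tensor_pairing_skew_part:
  assumes s: "vector_space s" and r: "r \<in> tensor_square s"
    and u: "u \<in> dual_space s" and v: "v \<in> dual_space s"
  shows "tensor_pairing s (skew_part s r) u v = tensor_pairing s r u v - tensor_pairing s r v u"
proof -
  from r obtain n :: nat and a b where t: "r = (\<Sum>i<n. tens2 s (a i) (b i))"
    by (auto simp: tensor_square_def)
  have "tensor_pairing s (skew_part s r) u v = skew_part s r (\<lambda>x y. u x * v y)"
    by (rule tensor_pairing_eq_apply[OF s skew_part_in_tensor_square[OF s r] u v])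
  then show ?thesis
    using bilinear_map_product[OF s u v]
    by (simp add: t skew_part_def tensor_flip_sum[OF s] tensor_pairing_sum[OF s u v]
        tensor_pairing_sum[OF s v u] sum_fun_apply tens2_apply mult.commute)
qed

text \<open>The explicit sums settle the two definite descriptions; the invariance arguments below
  know the induced maps only through these pairings.\<close>

lemma tensor_pairing_tilde:
  assumes s: "vector_space s" and r: "r \<in> tensor_square s"
    and u: "u \<in> dual_space s" and v: "v \<in> dual_space s"
  shows "v (tilde s r u) = tensor_pairing s r u v" "u (tilde_t s r v) = tensor_pairing s r u v"
proof -
  from r obtain n :: nat and a b where t: "r = (\<Sum>i<n. tens2 s (a i) (b i))"
    by (auto simp: tensor_square_def)
  interpret u: Vector_Spaces.linear s "(*)" u using u by (simp add: dual_space_def)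
  interpret v: Vector_Spaces.linear s "(*)" v using v by (simp add: dual_space_def)
  show "v (tilde s r u) = tensor_pairing s r u v" "u (tilde_t s r v) = tensor_pairing s r u v"
    by (simp_all add: t tilde_sum[OF s u] tilde_t_sum[OF s v] tensor_pairing_sum[OF s u v]
        u.sum u.scale v.sum v.scale mult.commute)
qed

section \<open>Coordinates of 3-tensors\<close>

lemma (in finite_dimensional_vector_space) representation_Basis_in_dual_space:
  "(\<lambda>p. representation Basis p e) \<in> dual_space scale"
  by (simp add: dual_space_def Vector_Spaces.linear_iff vector_space_axioms field_vector_space
      span_Basis representation_add[OF independent_Basis] representation_scale[OF independent_Basis])

text \<open>A trilinear form is a combination of products of coordinate functionals, with its values
  on basis triples as coefficients. Expanding one slot at a time shows this; it follows that
  products of functionals suffice to detect a 3-tensor.\<close>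

lemma (in finite_dimensional_vector_space) tens3_expand:
  fixes \<gamma> :: "'b \<Rightarrow> 'b \<Rightarrow> 'b \<Rightarrow> 'a"
  assumes \<gamma>: "trilinear_map scale (*) \<gamma>"
  shows "tens3 scale x y z \<gamma> = (\<Sum>(e, e', e'')\<in>Basis \<times> Basis \<times> Basis.
    tens3 scale x y z (\<lambda>p q t. representation Basis p e * representation Basis q e'
      * representation Basis t e'') * \<gamma> e e' e'')"
proof -
  let ?c = "representation Basis"
  have B: "x \<in> span Basis" for x by (simp add: span_Basis)
  have lin: "f p = (\<Sum>e\<in>Basis. ?c p e * f e)" if "Vector_Spaces.linear scale (*) f"
    for f :: "'b \<Rightarrow> 'a" and p
  proof -
    interpret f: Vector_Spaces.linear scale "(*)" f by (rule that)
    have "f p = f (\<Sum>e\<in>Basis. ?c p e *s e)"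
      using sum_representation_eq[OF independent_Basis B finite_Basis order_refl] by simp
    then show ?thesis by (simp add: f.sum f.scale)
  qed
  have "\<gamma> x y z = (\<Sum>e\<in>Basis. ?c x e * \<gamma> e y z)"
    using \<gamma> by (intro lin) (simp add: trilinear_map_def)
  also have "\<dots> = (\<Sum>e\<in>Basis. ?c x e * (\<Sum>e'\<in>Basis. ?c y e' * \<gamma> e e' z))"
  proof (intro sum.cong refl arg_cong2[where f = "(*)"])
    show "\<gamma> e y z = (\<Sum>e'\<in>Basis. ?c y e' * \<gamma> e e' z)" for e
      using \<gamma> by (intro lin) (simp add: trilinear_map_def)
  qed
  also have "\<dots> = (\<Sum>e\<in>Basis. ?c x e * (\<Sum>e'\<in>Basis. ?c y e' *
      (\<Sum>e''\<in>Basis. ?c z e'' * \<gamma> e e' e'')))"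
  proof (intro sum.cong refl arg_cong2[where f = "(*)"])
    show "\<gamma> e e' z = (\<Sum>e''\<in>Basis. ?c z e'' * \<gamma> e e' e'')" for e e'
      using \<gamma> by (intro lin) (simp add: trilinear_map_def)
  qed
  finally show ?thesis
    using \<gamma> trilinear_map_product[OF vector_space_axioms representation_Basis_in_dual_space
        representation_Basis_in_dual_space representation_Basis_in_dual_space]
    by (simp add: tens3_def sum.cartesian_product[symmetric] sum_distrib_left mult.assoc)
qed

section \<open>The DAYBE tested on functionals\<close>

context dialgebra
begin

definition daybe_defect :: "('a, 'f) tensor2 \<Rightarrow> ('a \<Rightarrow> 'f) \<Rightarrow> ('a \<Rightarrow> 'f) \<Rightarrow> ('a \<Rightarrow> 'f) \<Rightarrow> 'f"
  where "daybe_defect r u v w =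
    w (tilde scale r u \<rhd> tilde scale r v) - v (tilde_t scale r w \<lhd> tilde scale r u)
    - u (star_prod (\<rhd>) (\<lhd>) (tilde_t scale r v) (tilde_t scale r w))"

lemma bilinear_star: "bilinear_map scale scale (star_prod (\<rhd>) (\<lhd>))"
  by (intro bilinear_star_prod vector_space_axioms bilinear_rprod bilinear_lprod)

text \<open>The defect is the value of the DAYBE tensor at a product of three functionals.
  Conversely, products of coordinate functionals already determine that tensor.\<close>

lemma daybe_iff_defect:
  assumes "r \<in> tensor_square scale"
  shows "daybe scale (\<rhd>) (\<lhd>) r \<longleftrightarrow>
    (\<forall>u\<in>dual_space scale. \<forall>v\<in>dual_space scale. \<forall>w\<in>dual_space scale. daybe_defect r u v w = 0)"
proof -
  note vs = vector_space_axioms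
  from assms obtain n :: nat and a b where r: "r = (\<Sum>i<n. tens2 scale (a i) (b i))"
    by (auto simp: tensor_square_def)
  define S where "S = (\<Sum>i<n. \<Sum>j<n. tens3 scale (a i) (a j) (b i \<rhd> b j)
    - tens3 scale (a j) (a i \<lhd> b j) (b i) - tens3 scale (star_prod (\<rhd>) (\<lhd>) (a i) (a j)) (b i) (b j))"
  have daybe: "daybe scale (\<rhd>) (\<lhd>) r \<longleftrightarrow> S = 0"
    unfolding r S_def by (rule daybe_sum_iff[OF vs bilinear_rprod bilinear_lprod])
  have defect: "S (\<lambda>x y z. u x * v y * w z) = daybe_defect r u v w"
    if u: "u \<in> dual_space scale" and v: "v \<in> dual_space scale" and w: "w \<in> dual_space scale"
    for u v w
  proof -
    have 1: "w (tilde scale r u \<rhd> tilde scale r v)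
        = (\<Sum>i<n. \<Sum>j<n. u (a i) * v (a j) * w (b i \<rhd> b j))"
      unfolding r tilde_sum[OF vs u] tilde_sum[OF vs v]
      by (rule dual_apply_bilinear_sum[OF vs bilinear_rprod w])
    \<comment> \<open>Here \<open>i\<close> comes from \<open>tilde_t\<close> and \<open>j\<close>
      from \<open>tilde\<close>, as in the second summand of \<open>S\<close>, so the terms match up
      to commutativity of scalars.\<close>
    have 2: "v (tilde_t scale r w \<lhd> tilde scale r u)
        = (\<Sum>i<n. \<Sum>j<n. w (b i) * u (a j) * v (a i \<lhd> b j))"
      unfolding r tilde_sum[OF vs u] tilde_t_sum[OF vs w]
      by (rule dual_apply_bilinear_sum[OF vs bilinear_lprod v])
    have 3: "u (star_prod (\<rhd>) (\<lhd>) (tilde_t scale r v) (tilde_t scale r w))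
        = (\<Sum>i<n. \<Sum>j<n. v (b i) * w (b j) * u (star_prod (\<rhd>) (\<lhd>) (a i) (a j)))"
      unfolding r tilde_t_sum[OF vs v] tilde_t_sum[OF vs w]
      by (rule dual_apply_bilinear_sum[OF vs bilinear_star u])
    show ?thesis
      unfolding daybe_defect_def 1 2 3 S_def sum_subtractf[symmetric] sum_fun_apply minus_apply
        tens3_apply[OF trilinear_map_product[OF vs u v w]]
      by (simp add: mult_ac)
  qed
  have expand: "S \<gamma> = (\<Sum>(e, e', e'')\<in>Basis \<times> Basis \<times> Basis.
      S (\<lambda>p q t. representation Basis p e * representation Basis q e'
        * representation Basis t e'') * \<gamma> e e' e'')"
    if \<gamma>: "trilinear_map scale (*) \<gamma>" for \<gamma>
  proof -
    let ?I = "Basis \<times> Basis \<times> Basis"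
    let ?\<beta> = "\<lambda>(e, e', e'') p q t. representation Basis p e * representation Basis q e'
        * representation Basis t e''"
    let ?g = "\<lambda>(e, e', e''). \<gamma> e e' e''"
    \<comment> \<open>Being recovered from coordinate values is a linear condition on
      \<open>T\<close>, hence it passes from simple tensors to \<open>S\<close>.\<close>
    define good where "good T \<longleftrightarrow> T \<gamma> = (\<Sum>k\<in>?I. T (?\<beta> k) * ?g k)" for T :: "('a, 'f) tensor3"
    have tens: "good (tens3 scale x y z)" for x y z
      unfolding good_def tens3_expand[OF \<gamma>, of x y z] by (simp add: case_prod_unfold)
    have diff: "good (T - T')" if "good T" "good T'" for T T'
      using that by (simp add: good_def left_diff_distrib sum_subtractf)
    have sums: "good (\<Sum>i\<in>I. T i)" if "\<And>i. good (T i)" for I :: "nat set" and T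
      using that unfolding good_def sum_fun_apply
      by (simp add: sum_distrib_right sum.swap[of _ ?I I])
    have "good S" unfolding S_def by (intro sums diff tens)
    then show ?thesis by (simp add: good_def case_prod_unfold)
  qed
  show ?thesis
  proof
    assume "daybe scale (\<rhd>) (\<lhd>) r"
    then show "\<forall>u\<in>dual_space scale. \<forall>v\<in>dual_space scale. \<forall>w\<in>dual_space scale.
        daybe_defect r u v w = 0"
      using daybe defect by (simp flip: defect)
  next
    assume *: "\<forall>u\<in>dual_space scale. \<forall>v\<in>dual_space scale. \<forall>w\<in>dual_space scale.
        daybe_defect r u v w = 0"
    have "S \<gamma> = 0" for \<gamma>
    proof (cases "trilinear_map scale (*) \<gamma>")
      case True
      show ?thesis
        unfolding expand[OF True]
        by (rule sum.neutral) (use * defect representation_Basis_in_dual_space in auto)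
    next
      \<comment> \<open>Off the trilinear forms, every \<open>tens3\<close> is 0 by
        convention.\<close>
      case False
      then show ?thesis by (simp add: S_def sum_fun_apply tens3_def)
    qed
    then show "daybe scale (\<rhd>) (\<lhd>) r" unfolding daybe by (simp add: fun_eq_iff)
  qed
qed

text \<open>Functionals separate points, and both \<open>w (tilde scale r f)\<close> and
  \<open>f (tilde_t scale r w)\<close> are the pairing of \<open>r\<close> with \<open>f\<close> and
  \<open>w\<close>. This reduces an equation between vectors to scalar tests.\<close>

lemma tilde_eq_iff:
  assumes r: "r \<in> tensor_square scale" and f: "f \<in> dual_space scale"
  shows "x = tilde scale r f \<longleftrightarrow> (\<forall>w\<in>dual_space scale. w x = f (tilde_t scale r w))"
  using functionals_separate[OF vector_space_axioms]
    tensor_pairing_tilde[OF vector_space_axioms r f] by metis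

section \<open>Consequences of invariance\<close>

text \<open>Each invariance condition is evaluated at the product of \<open>p\<close> and
  \<open>q\<close>; skew-symmetry allows the pairing to be read with \<open>\<delta>\<close> on
  either argument.\<close>

lemma invariant_skew_part:
  assumes r: "r \<in> tensor_square scale"
    and inv: "invariant_tensor scale (\<rhd>) (\<lhd>) (skew_part scale r)"
    and p: "p \<in> dual_space scale" and q: "q \<in> dual_space scale"
  defines "\<delta> \<equiv> \<lambda>u. tilde scale r u - tilde_t scale r u"
  shows "q (x \<lhd> \<delta> p) = p (star_prod (\<rhd>) (\<lhd>) (\<delta> q) x)"
    and "q (star_prod (\<rhd>) (\<lhd>) x (\<delta> p)) = - p (\<delta> q \<rhd> x)"
proof -
  note vs = vector_space_axioms
  note pair = tensor_pairing_tilde[OF vs r]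
  note map = tensor_map_apply_product[OF vs skew_part_in_tensor_square[OF vs r] _ _ p q]
  have skew: "tensor_pairing scale (skew_part scale r) f g = g (\<delta> f)"
      "tensor_pairing scale (skew_part scale r) f g = - f (\<delta> g)"
    if "f \<in> dual_space scale" "g \<in> dual_space scale" for f g
    using that pair[OF that] pair[OF that(2,1)]
    by (simp_all add: \<delta>_def tensor_pairing_skew_part[OF vs r] dual_space_apply_diff)
  \<comment> \<open>The map \<open>f\<close> is transposed onto \<open>p\<close>, so the form of
    \<open>skew\<close> with \<open>\<delta>\<close> on the untouched \<open>q\<close> is chosen;
    \<open>right\<close> exchanges the roles.\<close>
  have left: "tensor_map scale f id (skew_part scale r) (\<lambda>x y. p x * q y) = - p (f (\<delta> q))"
    if "Vector_Spaces.linear scale scale f" for f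
    using map[OF that linear_id] skew(2)[OF dual_space_compose[OF that p] q] by (simp add: id_def)
  have right: "tensor_map scale id g (skew_part scale r) (\<lambda>x y. p x * q y) = q (g (\<delta> p))"
    if "Vector_Spaces.linear scale scale g" for g
    using map[OF linear_id that] skew(1)[OF p dual_space_compose[OF that q]] by (simp add: id_def)
  have "tensor_map scale (Rmult (star_prod (\<rhd>) (\<lhd>)) x) id (skew_part scale r)
      + tensor_map scale id (Lmult (\<lhd>) x) (skew_part scale r) = 0"
    and "tensor_map scale (Rmult (\<rhd>) x) id (skew_part scale r)
      - tensor_map scale id (Lmult (star_prod (\<rhd>) (\<lhd>)) x) (skew_part scale r) = 0"
    using inv by (auto simp: invariant_tensor_def)
  from this[THEN fun_cong, of "\<lambda>x y. p x * q y"]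
  have "- p (Rmult (star_prod (\<rhd>) (\<lhd>)) x (\<delta> q)) + q (Lmult (\<lhd>) x (\<delta> p)) = 0"
    and "- p (Rmult (\<rhd>) x (\<delta> q)) - q (Lmult (star_prod (\<rhd>) (\<lhd>)) x (\<delta> p)) = 0"
    by (simp_all only: plus_fun_apply minus_apply zero_fun_apply left right linear_Rmult
        linear_Lmult bilinear_star bilinear_lprod bilinear_rprod)
  then show "q (x \<lhd> \<delta> p) = p (star_prod (\<rhd>) (\<lhd>) (\<delta> q) x)"
    and "q (star_prod (\<rhd>) (\<lhd>) x (\<delta> p)) = - p (\<delta> q \<rhd> x)"
    unfolding Rmult_def Lmult_def by algebra+
qed

text \<open>In the notation \<open>R\<close>, \<open>T\<close>, \<open>\<delta>\<close>, the
  instance at \<open>T w\<close> replaces \<open>v (T w \<star> \<delta> u)\<close> by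
  \<open>- u (\<delta> v \<rhd> T w)\<close>. Adding \<open>daybe_defect r v w u\<close> to the left
  side then leaves \<open>w (\<delta> u \<lhd> R v) + u (R v \<rhd> \<delta> w)\<close>, which
  vanishes by the sum of the two instances at \<open>R v\<close>.\<close>

lemma second_equation_defect:
  assumes r: "r \<in> tensor_square scale"
    and inv: "invariant_tensor scale (\<rhd>) (\<lhd>) (skew_part scale r)"
    and u: "u \<in> dual_space scale" and v: "v \<in> dual_space scale" and w: "w \<in> dual_space scale"
  shows "w (tilde scale r u \<lhd> tilde scale r v)
      + v (star_prod (\<rhd>) (\<lhd>) (tilde_t scale r w) (tilde scale r u))
      - u (tilde_t scale r v \<rhd> tilde_t scale r w) = - daybe_defect r v w u"
proof -
  note vs = vector_space_axioms
  note expand = star_prod_def bilinear_map_diff[OF vs vs bilinear_rprod]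
    bilinear_map_diff[OF vs vs bilinear_lprod] dual_space_apply_diff[OF u]
    dual_space_apply_diff[OF v] dual_space_apply_diff[OF w]
  show ?thesis
    using invariant_skew_part(2)[OF r inv u v, of "tilde_t scale r w"]
      invariant_skew_part[OF r inv w u, of "tilde scale r v"]
    unfolding daybe_defect_def expand by algebra
qed

end

section \<open>The two operator equations\<close>

theorem proposition3p21:
  fixes scale :: "'f::field_char_0 \<Rightarrow> 'a::ab_group_add \<Rightarrow> 'a"
    and Basis :: "'a set"
    and rprod :: "'a \<Rightarrow> 'a \<Rightarrow> 'a" (infixl "\<rhd>" 70)
    and lprod :: "'a \<Rightarrow> 'a \<Rightarrow> 'a" (infixl "\<lhd>" 70)
    and r :: "('a, 'f) tensor2"
  assumes "dialgebra scale Basis (\<rhd>) (\<lhd>)"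
    and "r \<in> tensor_square scale"
    and "invariant_tensor scale (\<rhd>) (\<lhd>) (skew_part scale r)"
  shows "daybe scale (\<rhd>) (\<lhd>) r \<longleftrightarrow>
    (\<forall>a\<in>dual_space scale. \<forall>b\<in>dual_space scale.
      tilde scale r a \<rhd> tilde scale r b =
        tilde scale r
          (- dual_action (Rmult (\<lhd>)) (tilde scale r a) b
           - dual_action (Lmult (star_prod (\<rhd>) (\<lhd>))) (tilde_t scale r b) a) \<and>
      tilde scale r a \<lhd> tilde scale r b =
        tilde scale r
          (dual_action (Rmult (star_prod (\<rhd>) (\<lhd>))) (tilde scale r a) b
           - dual_action (Lmult (\<rhd>)) (tilde_t scale r b) a))"
proof -
  interpret dialgebra scale Basis "(\<rhd>)" "(\<lhd>)" by (rule assms(1))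
  let ?D = "dual_space scale" and ?R = "tilde scale r" and ?T = "tilde_t scale r"
  let ?star = "star_prod (\<rhd>) (\<lhd>)"
  note r = assms(2)
  note dual = dual_space_compose[OF linear_Lmult, unfolded Lmult_def]
    dual_space_compose[OF linear_Rmult, unfolded Rmult_def]
  have first: "?R a \<rhd> ?R b = ?R (- dual_action (Rmult (\<lhd>)) (?R a) b - dual_action (Lmult ?star) (?T b) a)
      \<longleftrightarrow> (\<forall>w\<in>?D. daybe_defect r a b w = 0)" if a: "a \<in> ?D" and b: "b \<in> ?D" for a b
  proof -
    \<comment> \<open>Both outer minus signs cancel the one built into
      \<open>dual_action\<close>.\<close>
    have f: "- dual_action (Rmult (\<lhd>)) (?R a) b - dual_action (Lmult ?star) (?T b) a
        = (\<lambda>x. b (x \<lhd> ?R a) + a (?star (?T b) x))"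
      by (simp add: fun_eq_iff dual_action_def Lmult_def Rmult_def)
    \<comment> \<open>Membership in the dual space is what permits \<open>tilde_eq_iff\<close> to
      move the argument of \<open>?R\<close> onto \<open>?T w\<close>.\<close>
    have "(\<lambda>x. b (x \<lhd> ?R a) + a (?star (?T b) x)) \<in> ?D"
      by (rule dual_space_add[OF dual(2)[OF bilinear_lprod b] dual(1)[OF bilinear_star a]])
    then show ?thesis
      unfolding f tilde_eq_iff[OF r] by (simp add: tilde_eq_iff[OF r] daybe_defect_def algebra_simps)
  qed
  have second: "?R a \<lhd> ?R b = ?R (dual_action (Rmult ?star) (?R a) b - dual_action (Lmult (\<rhd>)) (?T b) a)
      \<longleftrightarrow> (\<forall>w\<in>?D. daybe_defect r b w a = 0)" if a: "a \<in> ?D" and b: "b \<in> ?D" for a b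
  proof -
    \<comment> \<open>Here only the second term has an outer minus sign, so the first one stays
      negative.\<close>
    have f: "dual_action (Rmult ?star) (?R a) b - dual_action (Lmult (\<rhd>)) (?T b) a
        = (\<lambda>x. a (?T b \<rhd> x) - b (?star x (?R a)))"
      by (simp add: fun_eq_iff dual_action_def Lmult_def Rmult_def)
    have "(\<lambda>x. a (?T b \<rhd> x) - b (?star x (?R a))) \<in> ?D"
      by (rule dual_space_diff[OF dual(1)[OF bilinear_rprod a] dual(2)[OF bilinear_star b]])
    then have "?R a \<lhd> ?R b = ?R (\<lambda>x. a (?T b \<rhd> x) - b (?star x (?R a))) \<longleftrightarrow>
        (\<forall>w\<in>?D. w (?R a \<lhd> ?R b) = a (?T b \<rhd> ?T w) - b (?star (?T w) (?R a)))"
      by (rule tilde_eq_iff[OF r])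
    also have "\<dots> \<longleftrightarrow> (\<forall>w\<in>?D. daybe_defect r b w a = 0)"
    proof (rule ball_cong[OF refl])
      show "w (?R a \<lhd> ?R b) = a (?T b \<rhd> ?T w) - b (?star (?T w) (?R a))
          \<longleftrightarrow> daybe_defect r b w a = 0" if "w \<in> ?D" for w
        using second_equation_defect[OF r assms(3) a b that] by (auto simp: algebra_simps)
    qed
    finally show ?thesis unfolding f .
  qed
  have "(\<forall>a\<in>?D. \<forall>b\<in>?D.
      ?R a \<rhd> ?R b = ?R (- dual_action (Rmult (\<lhd>)) (?R a) b - dual_action (Lmult ?star) (?T b) a) \<and>
      ?R a \<lhd> ?R b = ?R (dual_action (Rmult ?star) (?R a) b - dual_action (Lmult (\<rhd>)) (?T b) a))
    \<longleftrightarrow> (\<forall>a\<in>?D. \<forall>b\<in>?D. (\<forall>w\<in>?D. daybe_defect r a b w = 0) \<and> (\<forall>w\<in>?D. daybe_defect r b w a = 0))"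
    by (intro ball_cong refl arg_cong2[where f = "(\<and>)"] first second)
  \<comment> \<open>The two conjuncts involve the same triples of functionals up to a cyclic
    permutation.\<close>
  then show ?thesis
    unfolding daybe_iff_defect[OF r] by blast
qed

end
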